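(* $ex_4(10,\text{Berge-}K_5)=36$; that is, the largest number of hyperedges in a $4$-uniform Berge-$K_5$-free hypergraph on $10$ vertices is exactly $36$.
   Context: Hypergraphs are finite and simple (no repeated hyperedges). A hypergraph $\mathcal{H}$ is a Berge copy of a graph $F$ (a Berge-$F$) if $V(F)\subset V(\mathcal{H})$ and there is a bijection $f:E(F)\to E(\mathcal{H})$ such that $e\subset f(e)$ for every $e\in E(F)$. A hypergraph is Berge-$F$-free if it contains no Berge-$F$ as a subhypergraph (not necessarily induced). $ex_r(n,\text{Berge-}F)$ is the largest number of hyperedges in an $r$-uniform (every hyperedge has exactly $r$ vertices) Berge-$F$-free hypergraph on $n$ vertices. $K_5$ is the complete graph on $5$ vertices. *)

theory Defs
  imports Main
begin

text \<open>A hypergraph is a pair of a vertex set and a set of hyperedges; hyperedges being a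
  set, there are no repeated ones. Graphs are the 2-uniform hypergraphs.\<close>

type_synonym 'a hypergraph = "'a set \<times> 'a set set"

abbreviation verts :: "'a hypergraph \<Rightarrow> 'a set" where
  "verts H \<equiv> fst H"

abbreviation hyperedges :: "'a hypergraph \<Rightarrow> 'a set set" where
  "hyperedges H \<equiv> snd H"

definition is_hypergraph :: "'a hypergraph \<Rightarrow> bool" where
  "is_hypergraph H \<longleftrightarrow> finite (verts H) \<and> (\<forall>h \<in> hyperedges H. h \<subseteq> verts H)"

definition uniform :: "nat \<Rightarrow> 'a hypergraph \<Rightarrow> bool" where
  "uniform r H \<longleftrightarrow> (\<forall>h \<in> hyperedges H. card h = r)"

definition subhypergraph :: "'a hypergraph \<Rightarrow> 'a hypergraph \<Rightarrow> bool" where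
  "subhypergraph H' H \<longleftrightarrow>
     is_hypergraph H' \<and> verts H' \<subseteq> verts H \<and> hyperedges H' \<subseteq> hyperedges H"

definition isomorphic :: "'a hypergraph \<Rightarrow> 'b hypergraph \<Rightarrow> bool" where
  "isomorphic F G \<longleftrightarrow>
     (\<exists>g. bij_betw g (verts F) (verts G) \<and> hyperedges G = (\<lambda>e. g ` e) ` hyperedges F)"

definition complete_graph :: "nat \<Rightarrow> nat hypergraph" where
  "complete_graph k = ({..<k}, {e. e \<subseteq> {..<k} \<and> card e = 2})"

text \<open>\<open>berge_copy F H\<close>: the hypergraph \<open>H\<close> is a Berge copy of the graph \<open>F\<close>.\<close>

definition berge_copy :: "'a hypergraph \<Rightarrow> 'a hypergraph \<Rightarrow> bool" where
  "berge_copy F H \<longleftrightarrow> verts F \<subseteq> verts H \<and>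
     (\<exists>f. bij_betw f (hyperedges F) (hyperedges H) \<and> (\<forall>e \<in> hyperedges F. e \<subseteq> f e))"

text \<open>The condition \<open>verts F \<subseteq> verts H\<close> refers to a concrete placement of the graph, so
  containing a Berge-\<open>F\<close> means containing a Berge copy of some graph isomorphic to \<open>F\<close>.\<close>

definition berge_free :: "'b hypergraph \<Rightarrow> 'a hypergraph \<Rightarrow> bool" where
  "berge_free F H \<longleftrightarrow>
     \<not> (\<exists>F' H'. isomorphic F F' \<and> subhypergraph H' H \<and> berge_copy F' H')"

text \<open>Vertices are natural numbers; this loses nothing, since every finite hypergraph is
  isomorphic to one of this kind.\<close>

definition berge_free_sizes :: "nat \<Rightarrow> nat \<Rightarrow> 'b hypergraph \<Rightarrow> nat set" where
  "berge_free_sizes r n F =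
     {card (hyperedges H) | H :: nat hypergraph.
        is_hypergraph H \<and> uniform r H \<and> card (verts H) = n \<and> berge_free F H}"

definition ex_berge :: "nat \<Rightarrow> nat \<Rightarrow> 'b hypergraph \<Rightarrow> nat" where
  "ex_berge r n F = Max (berge_free_sizes r n F)"

text \<open>The maximum ranges over a finite set, which is nonempty as soon as \<open>F\<close> has an edge.\<close>

lemma finite_berge_free_sizes: "finite (berge_free_sizes r n F)"
proof (rule finite_subset)
  show "berge_free_sizes r n F \<subseteq> {..2 ^ n}"
  proof
    fix m assume "m \<in> berge_free_sizes r n F"
    then obtain H :: "nat hypergraph" where H: "m = card (hyperedges H)" "is_hypergraph H"
      "card (verts H) = n" unfolding berge_free_sizes_def by blast
    then have "finite (verts H)" "hyperedges H \<subseteq> Pow (verts H)"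
      unfolding is_hypergraph_def by auto
    then have "card (hyperedges H) \<le> card (Pow (verts H))"
      by (intro card_mono) auto
    then show "m \<in> {..2 ^ n}" using H \<open>finite (verts H)\<close> by (simp add: card_Pow)
  qed
qed simp

lemma berge_free_sizes_nonempty:
  assumes "hyperedges F \<noteq> {}"
  shows "berge_free_sizes r n F \<noteq> {}"
proof -
  let ?H = "({..<n}, {}) :: nat hypergraph"
  have "berge_free F ?H"
    using assms unfolding berge_free_def isomorphic_def subhypergraph_def berge_copy_def
    by (auto simp: bij_betw_def)
  then have "card (hyperedges ?H) \<in> berge_free_sizes r n F"
    unfolding berge_free_sizes_def is_hypergraph_def uniform_def by fastforce
  then show ?thesis by blast
qed

end

theory Submission
  imports Defs
begin

text \<open>The lower bound is the complete 4-partite hypergraph with parts of sizes 3, 3, 2, 2: among any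
five vertices two lie in the same part, and no hyperedge contains both.

For the upper bound let a 4-uniform Berge-\<open>K\<^sub>5\<close>-free hypergraph \<open>H\<close> on 10 vertices be given. Match
hyperedges with pairs of vertices they contain. Taking a set \<open>U\<close> of hyperedges of maximal
deficiency in this bipartite incidence relation, Hall's theorem (\<open>hall\<close>, \<open>deficiency_split\<close>)
matches the hyperedges outside \<open>U\<close> with distinct pairs that lie in no member of \<open>U\<close>, and
matches all pairs inside members of \<open>U\<close> with distinct members of \<open>U\<close>. Replace every
hyperedge outside \<open>U\<close> by its pair. The result (\<open>reduce_to_mixed\<close>) is a family of \<open>card H\<close>
many 2-sets and 4-sets, an antichain, and the graph of the pairs covered by it has no \<open>K\<^sub>5\<close>, since
all its edges are matched with distinct hyperedges.

Give 2-sets weight 36 and 4-sets weight 37. Zykov symmetrization shows that in a family of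
maximal weight the relation of not being covered together is an equivalence with at most four
classes (\<open>optimal_nonadjacent_trans\<close>, \<open>optimal_four_colouring\<close>), and averaging over the
transversals of the four classes bounds the weight by \<open>36 * 37\<close> (\<open>multipartite_wt_le\<close>).
The weights balance the two extreme families on parts 3, 3, 2, 2, namely the 37 pairs
between different parts and the 36 transversals. Equal weights would not do: those 37 pairs are a legitimate family, so counting
members alone cannot give 36.

With these weights, a family of at least 37 members has weight at least \<open>36 * 37\<close>, with equality
only for 37 pairs. So a hypergraph \<open>H\<close> with more than 36 hyperedges has exactly 37, all matched
with pairs, and these pairs form an optimal family, i.e. a complete 4-partite graph. There are at
most 36 transversals, hence some hyperedge of \<open>H\<close> contains two vertices of the same part.
Rematching this hyperedge with that pair produces a Berge-\<open>K\<^sub>5\<close>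
(\<open>saturated_edges_transversal\<close>), a contradiction.\<close>

section \<open>Hall's theorem and the deficiency decomposition\<close>

text \<open>The proof of Halmos and Vaughan: either some proper nonempty \<open>J\<close> is tight, and then \<open>J\<close> and its
complement (with the neighbours of \<open>J\<close> removed) are matched separately; or there is slack
everywhere, and then any single choice can be made first.\<close>

lemma hall:
  fixes N :: "'i \<Rightarrow> 'b set"
  assumes "finite I" and "\<And>i. i \<in> I \<Longrightarrow> finite (N i)"
    and "\<And>J. J \<subseteq> I \<Longrightarrow> card J \<le> card (\<Union> (N ` J))"
  shows "\<exists>f. inj_on f I \<and> (\<forall>i\<in>I. f i \<in> N i)"
  using assms
proof (induction "card I" arbitrary: I N rule: less_induct)
  case less
  note fin = less.prems(1) and finN = less.prems(2) and hall = less.prems(3)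
  have finU: "finite (\<Union> (N ` J))" if "J \<subseteq> I" for J
    using that fin finN by (meson finite_UN_I finite_subset subsetD)
  show ?case
  proof (cases "\<exists>J. J \<subseteq> I \<and> J \<noteq> {} \<and> J \<noteq> I \<and> card (\<Union> (N ` J)) \<le> card J")
    case True
    then obtain J where J: "J \<subseteq> I" "J \<noteq> {}" "J \<noteq> I" "card (\<Union> (N ` J)) \<le> card J" by blast
    have finJ: "finite J" using J(1) fin finite_subset by blast
    have "card J < card I" using J fin by (simp add: psubset_card_mono psubsetI)
    then have "\<exists>f. inj_on f J \<and> (\<forall>i\<in>J. f i \<in> N i)"
      using less.hyps[of J N] finJ finN hall J(1) by (meson order_trans subsetD)
    then obtain f where f: "inj_on f J" "\<forall>i\<in>J. f i \<in> N i" by blast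
    define N' where "N' i = N i - \<Union> (N ` J)" for i
    have "card (I - J) < card I" using J fin
      by (metis Diff_subset Diff_disjoint Int_absorb1 Int_commute double_diff psubsetI psubset_card_mono)
    moreover have "card K \<le> card (\<Union> (N' ` K))" if K: "K \<subseteq> I - J" for K
    proof -
      have finK: "finite K" using K fin finite_subset by blast
      have "card K + card J = card (K \<union> J)"
        using K finK finJ by (subst card_Un_disjoint) auto
      also have "\<dots> \<le> card (\<Union> (N ` (K \<union> J)))" using hall[of "K \<union> J"] K J(1) by auto
      also have "\<Union> (N ` (K \<union> J)) = \<Union> (N' ` K) \<union> \<Union> (N ` J)" unfolding N'_def by auto
      also have "card \<dots> \<le> card (\<Union> (N' ` K)) + card (\<Union> (N ` J))" by (rule card_Un_le)
      finally show ?thesis using J(4) by linarith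
    qed
    ultimately have "\<exists>g. inj_on g (I - J) \<and> (\<forall>i\<in>I - J. g i \<in> N' i)"
      using less.hyps[of "I - J" N'] fin finN unfolding N'_def by auto
    then obtain g where g: "inj_on g (I - J)" "\<forall>i\<in>I - J. g i \<in> N' i" by blast
    let ?h = "\<lambda>i. if i \<in> J then f i else g i"
    have cross: "f i \<noteq> g j" if "i \<in> J" "j \<in> I - J" for i j
      using f(2) g(2) that unfolding N'_def by fastforce
    have "inj_on ?h I"
    proof (rule inj_onI)
      fix i j assume "i \<in> I" "j \<in> I" "?h i = ?h j"
      then show "i = j"
        using f(1) g(1) cross[of i j] cross[of j i] by (auto simp: inj_on_def split: if_splits)
    qed
    moreover have "\<forall>i\<in>I. ?h i \<in> N i" using f(2) g(2) unfolding N'_def by auto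
    ultimately show ?thesis by blast
  next
    case False
    show ?thesis
    proof (cases "I = {}")
      case True then show ?thesis by simp
    next
      case nonempty: False
      then obtain i where i: "i \<in> I" by blast
      have "card {i} \<le> card (N i)" using hall[of "{i}"] i by simp
      then obtain x where x: "x \<in> N i" by fastforce
      define N' where "N' j = N j - {x}" for j
      have "card (I - {i}) < card I" using i fin by (simp add: card_gt_0_iff nonempty)
      moreover have "card K \<le> card (\<Union> (N' ` K))" if K: "K \<subseteq> I - {i}" for K
      proof (cases "K = {}")
        case ne: False
        have "K \<subseteq> I" "K \<noteq> I" using K i by auto
        then have "card K < card (\<Union> (N ` K))" using False ne not_le by blast
        moreover have "\<Union> (N ` K) \<subseteq> insert x (\<Union> (N' ` K))" unfolding N'_def by auto
        then have "card (\<Union> (N ` K)) \<le> card (insert x (\<Union> (N' ` K)))"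
          using finU[of K] K unfolding N'_def
          by (intro card_mono) (auto intro: finite_subset[OF _ finU[of K]])
        moreover have "card (insert x (\<Union> (N' ` K))) \<le> Suc (card (\<Union> (N' ` K)))"
          by (metis card_insert_if card.infinite finite_insert le_Suc_eq nle_le le0)
        ultimately show ?thesis by linarith
      qed simp
      ultimately have "\<exists>g. inj_on g (I - {i}) \<and> (\<forall>j\<in>I - {i}. g j \<in> N' j)"
        using less.hyps[of "I - {i}" N'] fin finN unfolding N'_def by auto
      then obtain g where g: "inj_on g (I - {i})" "\<forall>j\<in>I - {i}. g j \<in> N' j" by blast
      have "inj_on (g(i := x)) I \<and> (\<forall>j\<in>I. (g(i := x)) j \<in> N j)"
        using g x unfolding N'_def inj_on_def by auto
      then show ?thesis by blast
    qed
  qed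
qed

text \<open>A set of maximal deficiency \<open>card U - card (N U)\<close> makes Hall's condition hold on both sides: adding
indices to \<open>U\<close> cannot raise the deficiency, which gives the condition outside \<open>U\<close>; removing the
neighbours of a set of values cannot raise it either, which gives the condition for matching
the values back into \<open>U\<close>.\<close>

lemma deficiency_split:
  fixes N :: "'i \<Rightarrow> 'b set"
  assumes fin: "finite I" and finN: "\<And>i. i \<in> I \<Longrightarrow> finite (N i)"
  obtains U f g where "U \<subseteq> I"
    "inj_on f (I - U)" "\<And>i. i \<in> I - U \<Longrightarrow> f i \<in> N i - \<Union> (N ` U)"
    "inj_on g (\<Union> (N ` U))" "\<And>p. p \<in> \<Union> (N ` U) \<Longrightarrow> g p \<in> U \<and> p \<in> N (g p)"
proof -
  define d where "d U = int (card U) - int (card (\<Union> (N ` U)))" for U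
  have "finite (d ` Pow I)" "d ` Pow I \<noteq> {}" using fin by auto
  then have "Max (d ` Pow I) \<in> d ` Pow I" by (rule Max_in)
  then obtain U where U: "U \<subseteq> I" "d U = Max (d ` Pow I)" by auto
  have max: "d U' \<le> d U" if "U' \<subseteq> I" for U'
    unfolding U(2) using that fin by (intro Max_ge) auto
  have finU: "finite (\<Union> (N ` J))" if "J \<subseteq> I" for J
    using that fin finN by (meson finite_UN_I finite_subset subsetD)
  have finI: "finite J" if "J \<subseteq> I" for J using that fin finite_subset by blast
  have "\<exists>f. inj_on f (I - U) \<and> (\<forall>i\<in>I - U. f i \<in> N i - \<Union> (N ` U))"
  proof (rule hall)
    fix J assume J: "J \<subseteq> I - U"
    have "card (\<Union> (N ` (U \<union> J))) = card (\<Union> (N ` U)) + card (\<Union>i\<in>J. N i - \<Union> (N ` U))"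
      using finU[of U] finU[of J] U(1) J
      by (subst card_Un_disjoint[symmetric]) (auto intro: finite_subset[OF _ finU[of J]] arg_cong[where f=card])
    moreover have "card (U \<union> J) = card U + card J"
      using J finI[OF U(1)] finI[of J] by (intro card_Un_disjoint) auto
    moreover have "d (U \<union> J) \<le> d U" using max[of "U \<union> J"] U(1) J by blast
    ultimately show "card J \<le> card (\<Union>i\<in>J. N i - \<Union> (N ` U))" unfolding d_def by linarith
  qed (use fin finN in auto)
  then obtain f where f: "inj_on f (I - U)" "\<forall>i\<in>I - U. f i \<in> N i - \<Union> (N ` U)" by blast
  have "\<exists>g. inj_on g (\<Union> (N ` U)) \<and> (\<forall>p\<in>\<Union> (N ` U). g p \<in> {i \<in> U. p \<in> N i})"
  proof (rule hall)
    fix P assume P: "P \<subseteq> \<Union> (N ` U)"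
    define R where "R = (\<Union>p\<in>P. {i \<in> U. p \<in> N i})"
    have R: "R \<subseteq> U" unfolding R_def by blast
    have "\<Union> (N ` (U - R)) \<subseteq> \<Union> (N ` U) - P" unfolding R_def by blast
    then have "card (\<Union> (N ` (U - R))) \<le> card (\<Union> (N ` U) - P)"
      using finU[OF U(1)] by (intro card_mono) auto
    also have "\<dots> = card (\<Union> (N ` U)) - card P"
      using P finU[OF U(1)] by (simp add: card_Diff_subset finite_subset)
    finally have "card (\<Union> (N ` (U - R))) + card P \<le> card (\<Union> (N ` U))"
      using card_mono[OF finU[OF U(1)] P] by linarith
    moreover have "card (U - R) + card R = card U"
      using R finI[OF U(1)] by (metis card_Diff_subset card_mono finite_subset le_add_diff_inverse2)
    moreover have "d (U - R) \<le> d U" using max U(1) by blast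
    ultimately show "card P \<le> card (\<Union>p\<in>P. {i \<in> U. p \<in> N i})"
      unfolding d_def R_def[symmetric] by linarith
  qed (use finU[OF U(1)] finI[OF U(1)] in auto)
  then obtain g where "inj_on g (\<Union> (N ` U))" "\<forall>p\<in>\<Union> (N ` U). g p \<in> {i \<in> U. p \<in> N i}" by blast
  with f U(1) show ?thesis by (intro that[of U f g]) auto
qed

section \<open>Mixed families and Zykov symmetrization\<close>

definition covers :: "'a set set \<Rightarrow> 'a \<Rightarrow> 'a \<Rightarrow> bool" where
  "covers F u v \<longleftrightarrow> (\<exists>S\<in>F. u \<in> S \<and> v \<in> S)"

text \<open>A common generalization of \<open>K\<^sub>5\<close>-free graphs and of 4-uniform families with \<open>K\<^sub>5\<close>-free shadow; it is
a red-blue coloured graph whose red edges are the 2-sets and whose 4-sets are blue cliques.\<close>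

definition mixed :: "'a set \<Rightarrow> 'a set set \<Rightarrow> bool" where
  "mixed V F \<longleftrightarrow> (\<forall>S\<in>F. S \<subseteq> V \<and> (card S = 2 \<or> card S = 4)) \<and>
     (\<forall>S\<in>F. \<forall>T\<in>F. S \<subseteq> T \<longrightarrow> S = T) \<and>
     \<not> (\<exists>X\<subseteq>V. card X = 5 \<and> (\<forall>u\<in>X. \<forall>v\<in>X. u \<noteq> v \<longrightarrow> covers F u v))"

text \<open>On parts 3, 3, 2, 2, the complete 4-partite graph has 37 edges and 36 transversals, so these weights
give both families the weight \<open>36 * 37\<close>.\<close>

definition wt :: "'a set set \<Rightarrow> nat" where
  "wt F = (\<Sum>S\<in>F. if card S = 2 then 36 else 37)"

text \<open>Zykov's operation: \<open>x\<close> is deleted and reinserted as a twin of \<open>y\<close>.\<close>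

definition clone :: "'a \<Rightarrow> 'a \<Rightarrow> 'a set set \<Rightarrow> 'a set set" where
  "clone x y F = {S \<in> F. x \<notin> S} \<union> (\<lambda>S. insert x (S - {y})) ` {S \<in> F. y \<in> S}"

lemma covers_commute: "covers F u v = covers F v u"
  unfolding covers_def by blast

lemma wt_split:
  assumes "finite F"
  shows "wt F = wt {S \<in> F. \<not> P S} + wt {S \<in> F. P S}"
  unfolding wt_def using assms
  by (subst sum.union_disjoint[symmetric]) (auto intro: sum.cong)

lemma finite_mixed: "mixed V F \<Longrightarrow> finite V \<Longrightarrow> finite F"
  unfolding mixed_def by (rule finite_subset[of _ "Pow V"]) auto

lemma mixedD:
  assumes "mixed V F"
  shows "S \<in> F \<Longrightarrow> S \<subseteq> V" "S \<in> F \<Longrightarrow> card S = 2 \<or> card S = 4"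
    "S \<in> F \<Longrightarrow> T \<in> F \<Longrightarrow> S \<subseteq> T \<Longrightarrow> S = T"
    "card X = 5 \<Longrightarrow> X \<subseteq> V \<Longrightarrow> (\<And>u v. u \<in> X \<Longrightarrow> v \<in> X \<Longrightarrow> u \<noteq> v \<Longrightarrow> covers F u v) \<Longrightarrow> False"
  using assms unfolding mixed_def by auto

text \<open>For \<open>x\<close> and \<open>y\<close> not covered together, the cloned family is the pullback of \<open>F\<close> along the map
that sends \<open>x\<close> to \<open>y\<close>. All properties of mixed families transfer along this map.\<close>

lemma clone_back:
  assumes "\<not> covers F x y" "T \<in> clone x y F"
  shows "(id(x := y)) ` T \<in> F" "inj_on (id(x := y)) T" "\<not> (x \<in> T \<and> y \<in> T)"
proof -
  show nb: "\<not> (x \<in> T \<and> y \<in> T)"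
    using assms unfolding clone_def covers_def by auto
  consider "T \<in> F" "x \<notin> T" | S where "S \<in> F" "y \<in> S" "T = insert x (S - {y})"
    using assms(2) unfolding clone_def by blast
  then show "(id(x := y)) ` T \<in> F"
  proof cases
    case 1
    then have "(id(x := y)) ` T = T" by force
    then show ?thesis using 1 by simp
  next
    case 2
    then have "x \<notin> S" using assms(1) unfolding covers_def by blast
    then have "(id(x := y)) ` T = S" using 2 by force
    then show ?thesis using 2 by simp
  qed
  show "inj_on (id(x := y)) T" using nb unfolding inj_on_def by auto
qed

lemma mixed_clone:
  assumes F: "mixed V F" and x: "x \<in> V" and y: "y \<in> V" and nc: "\<not> covers F x y"
  shows "mixed V (clone x y F)"
proof -
  define s where "s = id(x := y)"
  note preimage = clone_back[OF nc, folded s_def]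
  have img: "s ` T \<subseteq> V \<Longrightarrow> T \<subseteq> V" for T
    using x by (auto simp: s_def image_subset_iff split: if_splits)
  have edge: "T \<subseteq> V \<and> (card T = 2 \<or> card T = 4)" if "T \<in> clone x y F" for T
  proof -
    have T: "s ` T \<subseteq> V" "card (s ` T) = 2 \<or> card (s ` T) = 4"
      using mixedD(1,2)[OF F preimage(1)[OF that]] by auto
    then show ?thesis using img[OF T(1)] card_image[OF preimage(2)[OF that]] by simp
  qed
  have antichain: "S = T" if "S \<in> clone x y F" "T \<in> clone x y F" "S \<subseteq> T" for S T
  proof -
    have "s ` S = s ` T"
      using mixedD(3)[OF F preimage(1)[OF that(1)] preimage(1)[OF that(2)]] image_mono[OF that(3)] .
    then show ?thesis using preimage(2)[OF that(2)] that(3) by (metis inj_on_image_eq_iff order_refl)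
  qed
  have no_K5: False
    if X: "X \<subseteq> V" "card X = 5" "\<And>u v. u \<in> X \<Longrightarrow> v \<in> X \<Longrightarrow> u \<noteq> v \<Longrightarrow> covers (clone x y F) u v" for X
  proof -
    have inj: "inj_on s X"
    proof (rule inj_onI, rule ccontr)
      fix u v assume uv: "u \<in> X" "v \<in> X" "s u = s v" "u \<noteq> v"
      then obtain T where "T \<in> clone x y F" "u \<in> T" "v \<in> T" using X(3) unfolding covers_def by blast
      then show False using preimage(2) uv by (meson inj_onD)
    qed
    have "card (s ` X) = 5" using card_image[OF inj] X(2) by simp
    moreover have "s ` X \<subseteq> V" using X(1) y by (auto simp: s_def)
    moreover have "covers F u v" if uv: "u \<in> s ` X" "v \<in> s ` X" "u \<noteq> v" for u v
    proof -
      obtain a b where ab: "a \<in> X" "b \<in> X" "u = s a" "v = s b" using uv by blast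
      then have "a \<noteq> b" using uv by blast
      then obtain T where "T \<in> clone x y F" "a \<in> T" "b \<in> T" using X(3) ab unfolding covers_def by blast
      then show ?thesis using preimage(1) ab unfolding covers_def by blast
    qed
    ultimately show False by (rule mixedD(4)[OF F])
  qed
  show ?thesis unfolding mixed_def
    using edge antichain no_K5 by (intro conjI ballI impI notI; (elim exE conjE)?) meson+
qed

lemma wt_clone:
  assumes fin: "finite F" and nc: "\<not> covers F x y"
  shows "wt (clone x y F) + wt {S \<in> F. x \<in> S} = wt F + wt {S \<in> F. y \<in> S}"
proof -
  let ?m = "\<lambda>S. insert x (S - {y})"
  have inj: "inj_on ?m {S \<in> F. y \<in> S}"
  proof (rule inj_onI)
    fix S T assume ST: "S \<in> {S \<in> F. y \<in> S}" "T \<in> {S \<in> F. y \<in> S}" "?m S = ?m T"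
    then have "x \<notin> S" "x \<notin> T" using nc unfolding covers_def by auto
    then have "S = insert y (?m S - {x})" "T = insert y (?m T - {x})" using ST(1,2) by auto
    then show "S = T" using ST(3) by simp
  qed
  have card: "card (?m S) = card S" if "S \<in> F" "y \<in> S" for S
  proof -
    have "x \<notin> S" using nc that unfolding covers_def by auto
    then show ?thesis using that(2)
      by (cases "finite S") (auto simp: card_insert_if card_Suc_Diff1 simp del: card_Diff_insert)
  qed
  have "wt (clone x y F) = wt {S \<in> F. x \<notin> S} + wt (?m ` {S \<in> F. y \<in> S})"
    unfolding clone_def wt_def using fin by (intro sum.union_disjoint) auto
  also have "wt (?m ` {S \<in> F. y \<in> S}) = wt {S \<in> F. y \<in> S}"
    unfolding wt_def using card by (subst sum.reindex[OF inj]) (auto intro!: sum.cong)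
  finally show ?thesis using wt_split[OF fin, of "\<lambda>S. x \<in> S"] by simp
qed

text \<open>In an optimal family two vertices \<open>x\<close>, \<open>y\<close> not covered together lie in members of the same total
weight, as otherwise cloning the heavier one would be an improvement. Suppose \<open>y\<close> is adjacent to
neither \<open>x\<close> nor \<open>z\<close>, but \<open>x\<close> and \<open>z\<close> are covered together. After replacing \<open>x\<close> by a clone of \<open>y\<close>
the family is still optimal, the weight at \<open>y\<close> is unchanged, but the weight at \<open>z\<close> has dropped by
that of the members containing \<open>x\<close> and \<open>z\<close>. This contradicts the equality of the weights at \<open>y\<close>
and \<open>z\<close>.\<close>

lemma optimal_nonadjacent_trans:
  assumes fin: "finite V" and F: "mixed V F" and max: "\<And>G. mixed V G \<Longrightarrow> wt G \<le> wt F"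
    and V: "x \<in> V" "y \<in> V" "z \<in> V" and d: "x \<noteq> y" "y \<noteq> z" "x \<noteq> z"
    and nc: "\<not> covers F x y" "\<not> covers F y z"
  shows "\<not> covers F x z"
proof
  assume cov: "covers F x z"
  have eq: "wt {S \<in> G. u \<in> S} = wt {S \<in> G. v \<in> S}"
    if G: "mixed V G" "wt G = wt F" and uv: "u \<in> V" "v \<in> V" "\<not> covers G u v" for G u v
  proof -
    have vu: "\<not> covers G v u" using uv(3) covers_commute by metis
    have "wt (clone u v G) \<le> wt G" "wt (clone v u G) \<le> wt G"
      unfolding G(2) using mixed_clone[OF G(1)] uv vu max by blast+
    then show ?thesis
      using wt_clone[OF finite_mixed[OF G(1) fin] uv(3)]
        wt_clone[OF finite_mixed[OF G(1) fin] vu] by linarith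
  qed
  have finF: "finite F" using finite_mixed[OF F fin] .
  define G where "G = clone x y F"
  have G: "mixed V G" unfolding G_def using mixed_clone F V nc by metis
  have wG: "wt G = wt F"
    using wt_clone[OF finF nc(1)] eq[OF F refl V(1,2) nc(1)] unfolding G_def by linarith
  have sy: "{S \<in> G. y \<in> S} = {S \<in> F. y \<in> S}"
    using nc(1) d unfolding G_def clone_def covers_def by auto
  have sz: "{S \<in> G. z \<in> S} = {S \<in> {S \<in> F. z \<in> S}. x \<notin> S}"
    using nc(2) d unfolding G_def clone_def covers_def by auto
  have "\<not> covers G y z" using sy nc(2) unfolding covers_def by blast
  from eq[OF G wG V(2,3) this] sy sz eq[OF F refl V(2,3) nc(2)]
  have "wt {S \<in> F. z \<in> S} = wt {S \<in> {S \<in> F. z \<in> S}. x \<notin> S}" by simp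
  then have "wt {S \<in> {S \<in> F. z \<in> S}. x \<in> S} = 0"
    using wt_split[of "{S \<in> F. z \<in> S}" "\<lambda>S. x \<in> S"] finF by simp
  moreover obtain S where "S \<in> F" "x \<in> S" "z \<in> S" using cov unfolding covers_def by blast
  ultimately show False using finF unfolding wt_def by (auto split: if_splits)
qed

text \<open>The colours are the classes of the relation of being equal or not covered together. Five classes would give
five representatives covered pairwise, that is, a \<open>K\<^sub>5\<close>.\<close>

lemma optimal_four_colouring:
  assumes fin: "finite V" and F: "mixed V F" and max: "\<And>G. mixed V G \<Longrightarrow> wt G \<le> wt F"
  obtains \<kappa> :: "'a \<Rightarrow> nat" where "\<kappa> ` V \<subseteq> {..<4}"
    "\<And>u v. u \<in> V \<Longrightarrow> v \<in> V \<Longrightarrow> u \<noteq> v \<Longrightarrow> covers F u v \<longleftrightarrow> \<kappa> u \<noteq> \<kappa> v"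
proof -
  define r where "r = {(u, v). u \<in> V \<and> v \<in> V \<and> (u = v \<or> \<not> covers F u v)}"
  have "equiv V r"
  proof (rule equivI)
    show "r \<subseteq> V \<times> V" "refl_on V r" unfolding r_def refl_on_def by auto
    show "sym r" unfolding r_def sym_def using covers_commute[of F] by auto
    show "trans r"
    proof (rule transI)
      fix x y z assume "(x, y) \<in> r" "(y, z) \<in> r"
      then show "(x, z) \<in> r"
        using optimal_nonadjacent_trans[OF fin F max, of x y z] unfolding r_def by auto
    qed
  qed
  have finQ: "finite (V // r)" using fin by (rule finite_quotient) (auto simp: r_def)
  have "card (V // r) \<le> 4"
  proof (rule ccontr)
    assume "\<not> ?thesis"
    then obtain Q where Q: "Q \<subseteq> V // r" "card Q = 5"
      using obtain_subset_with_card_n[of 5 "V // r"] by auto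
    define rep where "rep q = (SOME v. v \<in> q)" for q :: "'a set"
    have rep: "rep q \<in> q" if "q \<in> V // r" for q
      unfolding rep_def using in_quotient_imp_non_empty[OF \<open>equiv V r\<close> that] by (simp add: some_in_eq)
    have repV: "rep q \<in> V" if "q \<in> V // r" for q
      using rep[OF that] in_quotient_imp_subset[OF \<open>equiv V r\<close> that] by blast
    have inj: "p = q" if "p \<in> V // r" "q \<in> V // r" "(rep p, rep q) \<in> r" for p q
      using that rep quotient_eqI[OF \<open>equiv V r\<close>] by blast
    have "inj_on rep Q"
    proof (rule inj_onI)
      fix p q assume "p \<in> Q" "q \<in> Q" "rep p = rep q"
      then show "p = q" using Q(1) repV inj[of p q] unfolding r_def by auto
    qed
    then have "card (rep ` Q) = 5" using Q(2) card_image by metis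
    moreover have "rep ` Q \<subseteq> V" using Q(1) repV by blast
    moreover have "covers F u v" if uv: "u \<in> rep ` Q" "v \<in> rep ` Q" "u \<noteq> v" for u v
    proof (rule ccontr)
      assume n: "\<not> covers F u v"
      obtain p q where pq: "p \<in> Q" "q \<in> Q" "u = rep p" "v = rep q" using uv by blast
      then have "(rep p, rep q) \<in> r" using n Q(1) repV unfolding r_def by auto
      then show False using inj[of p q] pq Q(1) uv(3) by blast
    qed
    ultimately show False by (rule mixedD(4)[OF F])
  qed
  then obtain h where h: "inj_on h (V // r)" "h ` (V // r) \<subseteq> {..<4::nat}"
    using finQ inj_on_iff_card_le[of "V // r" "{..<4::nat}"] by auto
  show ?thesis
  proof
    show "(\<lambda>v. h (r `` {v})) ` V \<subseteq> {..<4}" using h(2) quotientI by fast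
    fix u v assume uv: "u \<in> V" "v \<in> V" "u \<noteq> v"
    have "h (r `` {u}) = h (r `` {v}) \<longleftrightarrow> r `` {u} = r `` {v}"
      using h(1) uv by (simp add: inj_on_eq_iff quotientI)
    also have "\<dots> \<longleftrightarrow> (u, v) \<in> r" using eq_equiv_class_iff[OF \<open>equiv V r\<close> uv(1,2)] .
    also have "\<dots> \<longleftrightarrow> \<not> covers F u v" using uv unfolding r_def by auto
    finally show "covers F u v \<longleftrightarrow> h (r `` {u}) \<noteq> h (r `` {v})" by blast
  qed
qed

section \<open>Sizes of four parts of a 10-element set\<close>

text \<open>The number of edges of the Turan graph on 10 vertices with 4 parts. Since the part sizes are
integers, \<open>(x - 2) * (x - 3) \<ge> 0\<close> for each of them, so their squares add up to at least 26.\<close>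

lemma pair_sum_le:
  fixes a b c d :: nat
  assumes "a + b + c + d = 10"
  shows "a*b + a*c + a*d + b*c + b*d + c*d \<le> 37"
proof -
  have sq: "5 * int x \<le> int x * int x + 6" for x :: nat
  proof -
    have "0 \<le> (int x - 2) * (int x - 3)" by (cases "x \<le> 2") (auto intro: mult_nonpos_nonpos)
    then show ?thesis by (simp add: algebra_simps)
  qed
  define s where "s = a*b + a*c + a*d + b*c + b*d + c*d"
  have sum: "int a + int b + int c + int d = 10" using assms by linarith
  have "int (a + b + c + d) * int (a + b + c + d) = 10 * 10" unfolding assms by simp
  then have "int a * int a + int b * int b + int c * int c + int d * int d + 2 * int s = 100"
    unfolding s_def by (simp add: algebra_simps)
  then show ?thesis
    using sq[of a] sq[of b] sq[of c] sq[of d] sum unfolding s_def[symmetric] by linarith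
qed

text \<open>If \<open>a \<le> 1\<close>, the other three sizes add up to at least 9, and already the estimate
\<open>(x - 3)\<^sup>2 \<ge> 0\<close> for them keeps the sum of products at 36 or below.\<close>

lemma two_le_part_if_pair_sum:
  fixes a b c d :: nat
  assumes "a + b + c + d = 10" "37 \<le> a*b + a*c + a*d + b*c + b*d + c*d"
  shows "2 \<le> a"
proof (rule ccontr)
  assume "\<not> 2 \<le> a"
  have sq: "6 * int x \<le> int x * int x + 9" for x :: nat
    using zero_le_square[of "int x - 3"] by (simp add: algebra_simps)
  define s where "s = a*b + a*c + a*d + b*c + b*d + c*d"
  have sum: "int a + int b + int c + int d = 10" using assms by linarith
  have "int (a + b + c + d) * int (a + b + c + d) = 10 * 10" unfolding assms by simp
  then have eq: "int a * int a + int b * int b + int c * int c + int d * int d + 2 * int s = 100"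
    unfolding s_def by (simp add: algebra_simps)
  consider "a = 0" | "a = 1" using \<open>\<not> 2 \<le> a\<close> by linarith
  then show False
  proof cases
    case 1
    then have "int b * int b + int c * int c + int d * int d + 2 * int s = 100" using eq by simp
    then show False
      using sq[of b] sq[of c] sq[of d] sum assms(2) 1 unfolding s_def[symmetric] by linarith
  next
    case 2
    then have "1 + int b * int b + int c * int c + int d * int d + 2 * int s = 100" using eq by simp
    then show False
      using sq[of b] sq[of c] sq[of d] sum assms(2) 2 unfolding s_def[symmetric] by linarith
  qed
qed

lemma prod_le:
  fixes a b c d :: nat
  assumes "a + b + c + d = 10"
  shows "a * b * c * d \<le> 36"
proof -
  have am: "4 * (x * y) \<le> (x + y) * (x + y)" for x y :: nat
  proof -
    have "0 \<le> (int x - int y) * (int x - int y)" by simp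
    then have "int (4 * (x * y)) \<le> int ((x + y) * (x + y))" by (simp add: algebra_simps)
    then show ?thesis by linarith
  qed
  define s where "s = a + b"
  have ab: "a * b \<le> s * s div 4" using am[of a b] unfolding s_def by linarith
  have "c + d = 10 - s" using assms unfolding s_def by linarith
  then have cd: "c * d \<le> (10 - s) * (10 - s) div 4" using am[of c d] by simp
  have "s \<le> 10" using assms unfolding s_def by simp
  then have "s = 0 \<or> s = 1 \<or> s = 2 \<or> s = 3 \<or> s = 4 \<or> s = 5 \<or> s = 6 \<or> s = 7 \<or> s = 8 \<or> s = 9 \<or> s = 10"
    by arith
  then have "(s * s div 4) * ((10 - s) * (10 - s) div 4) \<le> 36" by (elim disjE) simp_all
  moreover have "(a * b) * (c * d) \<le> (s * s div 4) * ((10 - s) * (10 - s) div 4)"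
    using ab cd by (rule mult_le_mono)
  ultimately show ?thesis by (simp add: mult.assoc)
qed

section \<open>The weight of a family on a complete 4-partite graph\<close>

lemma wt_eq:
  assumes "finite F"
  shows "wt F = 36 * card {S \<in> F. card S = 2} + 37 * card {S \<in> F. card S \<noteq> 2}"
  unfolding wt_def using assms
  by (simp add: sum.If_cases Int_def)

definition part :: "'a set \<Rightarrow> ('a \<Rightarrow> nat) \<Rightarrow> nat \<Rightarrow> 'a set" where
  "part V \<kappa> i = {v \<in> V. \<kappa> v = i}"

lemma card_parts:
  assumes "finite V" "\<kappa> ` V \<subseteq> {..<4}"
  shows "card (part V \<kappa> 0) + card (part V \<kappa> 1) + card (part V \<kappa> 2) + card (part V \<kappa> 3) = card V"
proof -
  have "card V = (\<Sum>i<4. card (part V \<kappa> i))"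
    unfolding part_def using sum.group[of V "{..<4}" \<kappa> "\<lambda>_. 1::nat"] assms by simp
  then show ?thesis by (simp add: numeral_eq_Suc)
qed

lemma card_pairs_le:
  assumes "finite A" "finite B"
  shows "card {S \<in> F. \<exists>u\<in>A. \<exists>v\<in>B. S = {u, v}} \<le> (\<Sum>u\<in>A. \<Sum>v\<in>B. of_bool ({u, v} \<in> F))"
proof -
  let ?X = "{p \<in> A \<times> B. {fst p, snd p} \<in> F}"
  have "card {S \<in> F. \<exists>u\<in>A. \<exists>v\<in>B. S = {u, v}} \<le> card ((\<lambda>p. {fst p, snd p}) ` ?X)"
  proof (rule card_mono)
    show "finite ((\<lambda>p. {fst p, snd p}) ` ?X)" using assms by auto
    show "{S \<in> F. \<exists>u\<in>A. \<exists>v\<in>B. S = {u, v}} \<subseteq> (\<lambda>p. {fst p, snd p}) ` ?X"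
    proof
      fix S assume "S \<in> {S \<in> F. \<exists>u\<in>A. \<exists>v\<in>B. S = {u, v}}"
      then obtain u v where "u \<in> A" "v \<in> B" "S = {u, v}" "S \<in> F" by blast
      then show "S \<in> (\<lambda>p. {fst p, snd p}) ` ?X" by (intro image_eqI[of _ _ "(u, v)"]) auto
    qed
  qed
  also have "\<dots> \<le> card ?X" using assms by (intro card_image_le) auto
  also have "\<dots> = (\<Sum>p\<in>A \<times> B. of_bool ({fst p, snd p} \<in> F))"
    using assms by (simp add: Int_def)
  also have "\<dots> = (\<Sum>u\<in>A. \<Sum>v\<in>B. of_bool ({u, v} \<in> F))"
    by (subst sum.cartesian_product) (simp add: case_prod_beta)
  finally show ?thesis .
qed

lemma card_quadruples_le:
  assumes "finite A" "finite B" "finite C" "finite D"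
  shows "card {S \<in> F. \<exists>a\<in>A. \<exists>b\<in>B. \<exists>c\<in>C. \<exists>d\<in>D. S = {a, b, c, d}}
    \<le> (\<Sum>a\<in>A. \<Sum>b\<in>B. \<Sum>c\<in>C. \<Sum>d\<in>D. of_bool ({a, b, c, d} \<in> F))"
proof -
  let ?s = "\<lambda>p::_\<times>_\<times>_\<times>_. {fst p, fst (snd p), fst (snd (snd p)), snd (snd (snd p))}"
  let ?X = "{p \<in> A \<times> B \<times> C \<times> D. ?s p \<in> F}"
  have "card {S \<in> F. \<exists>a\<in>A. \<exists>b\<in>B. \<exists>c\<in>C. \<exists>d\<in>D. S = {a, b, c, d}} \<le> card (?s ` ?X)"
  proof (rule card_mono)
    show "finite (?s ` ?X)" using assms by auto
    show "{S \<in> F. \<exists>a\<in>A. \<exists>b\<in>B. \<exists>c\<in>C. \<exists>d\<in>D. S = {a, b, c, d}} \<subseteq> ?s ` ?X"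
    proof
      fix S assume "S \<in> {S \<in> F. \<exists>a\<in>A. \<exists>b\<in>B. \<exists>c\<in>C. \<exists>d\<in>D. S = {a, b, c, d}}"
      then obtain a b c d where "a \<in> A" "b \<in> B" "c \<in> C" "d \<in> D" "S = {a, b, c, d}" "S \<in> F" by blast
      then show "S \<in> ?s ` ?X" by (intro image_eqI[of _ _ "(a, b, c, d)"]) auto
    qed
  qed
  also have "\<dots> \<le> card ?X" using assms by (intro card_image_le) auto
  also have "\<dots> = (\<Sum>p\<in>A \<times> B \<times> C \<times> D. of_bool (?s p \<in> F))"
    using assms by (simp add: Int_def)
  also have "\<dots> = (\<Sum>a\<in>A. \<Sum>b\<in>B. \<Sum>c\<in>C. \<Sum>d\<in>D. of_bool ({a, b, c, d} \<in> F))"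
    by (simp add: sum.cartesian_product')
  finally show ?thesis .
qed

lemma card_bichromatic_pairs_le:
  assumes fin: "finite V" and \<kappa>: "\<kappa> ` V \<subseteq> {..<4}"
    and F: "\<And>S. S \<in> F \<Longrightarrow> S \<subseteq> V \<and> card S = 2 \<and> inj_on \<kappa> S"
    and e: "\<And>i j. e i j = (\<Sum>u\<in>part V \<kappa> i. \<Sum>v\<in>part V \<kappa> j. of_bool ({u, v} \<in> F))"
  shows "card F \<le> e 0 1 + e 0 2 + e 0 3 + e 1 2 + e 1 3 + e 2 3"
proof -
  define M where "M i j = {S \<in> F. \<exists>u\<in>part V \<kappa> i. \<exists>v\<in>part V \<kappa> j. S = {u, v}}" for i j
  have finF: "finite F" using F fin by (intro finite_subset[of F "Pow V"]) auto
  have finP: "finite (part V \<kappa> i)" for i unfolding part_def using fin by simp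
  have Me: "card (M i j) \<le> e i j" for i j
    unfolding M_def e by (rule card_pairs_le[OF finP finP])
  have range: "\<kappa> v \<in> {0, 1, 2, 3}" if "v \<in> V" for v
  proof -
    have "\<kappa> v < 4" using \<kappa> that by auto
    then show ?thesis by auto
  qed
  have "F \<subseteq> M 0 1 \<union> M 0 2 \<union> M 0 3 \<union> M 1 2 \<union> M 1 3 \<union> M 2 3"
  proof
    fix S assume SF: "S \<in> F"
    then obtain u v where S: "S = {u, v}" "u \<noteq> v" using F[OF SF] card_2_iff[of S] by blast
    have uV: "u \<in> V" "v \<in> V" using F[OF SF] S(1) by auto
    then have uv: "u \<in> part V \<kappa> (\<kappa> u)" "v \<in> part V \<kappa> (\<kappa> v)" unfolding part_def by auto
    have ne: "\<kappa> u \<noteq> \<kappa> v" using F[OF SF] S by (auto simp: inj_on_def)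
    have M1: "S \<in> M (\<kappa> u) (\<kappa> v)" using SF S(1) uv unfolding M_def by blast
    have M2: "S \<in> M (\<kappa> v) (\<kappa> u)" using SF S(1) uv unfolding M_def by (blast intro: insert_commute)
    show "S \<in> M 0 1 \<union> M 0 2 \<union> M 0 3 \<union> M 1 2 \<union> M 1 3 \<union> M 2 3"
      using range[OF uV(1)] range[OF uV(2)] ne M1 M2 by auto
  qed
  then have "card F \<le> card (M 0 1 \<union> M 0 2 \<union> M 0 3 \<union> M 1 2 \<union> M 1 3 \<union> M 2 3)"
    using finF unfolding M_def by (intro card_mono) auto
  also have "\<dots> \<le> card (M 0 1) + card (M 0 2) + card (M 0 3) + card (M 1 2) + card (M 1 3) + card (M 2 3)"
    by (intro order_trans[OF card_Un_le] add_right_mono) simp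
  also have "\<dots> \<le> e 0 1 + e 0 2 + e 0 3 + e 1 2 + e 1 3 + e 2 3"
    by (intro add_mono Me)
  finally show ?thesis .
qed

lemma card_transversals_le:
  assumes fin: "finite V" and \<kappa>: "\<kappa> ` V \<subseteq> {..<4}"
    and F: "\<And>S. S \<in> F \<Longrightarrow> S \<subseteq> V \<and> card S = 4 \<and> inj_on \<kappa> S"
  shows "card F \<le> (\<Sum>x\<in>part V \<kappa> 0. \<Sum>y\<in>part V \<kappa> 1. \<Sum>z\<in>part V \<kappa> 2. \<Sum>w\<in>part V \<kappa> 3.
    of_bool ({x, y, z, w} \<in> F))"
proof -
  have finP: "finite (part V \<kappa> i)" for i unfolding part_def using fin by simp
  let ?P = "part V \<kappa>"
  have finF: "finite F" using F fin by (intro finite_subset[of F "Pow V"]) auto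
  have "card F \<le> card {S \<in> F. \<exists>x\<in>?P 0. \<exists>y\<in>?P 1. \<exists>z\<in>?P 2. \<exists>w\<in>?P 3. S = {x, y, z, w}}"
  proof (rule card_mono)
    show "F \<subseteq> {S \<in> F. \<exists>x\<in>?P 0. \<exists>y\<in>?P 1. \<exists>z\<in>?P 2. \<exists>w\<in>?P 3. S = {x, y, z, w}}"
    proof
      fix S assume SF: "S \<in> F"
      note S = F[OF SF]
      have finS: "finite S" using S fin finite_subset by blast
      have "card (\<kappa> ` S) = card {..<4::nat}" using S by (simp add: card_image)
      moreover have "\<kappa> ` S \<subseteq> {..<4}" using \<kappa> S by blast
      ultimately have im: "\<kappa> ` S = {..<4}" by (intro card_subset_eq) auto
      have ex: "\<exists>v\<in>S. \<kappa> v = i" if "i < 4" for i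
        using im that by (metis imageE lessThan_iff)
      obtain x where x: "x \<in> S" "\<kappa> x = 0" using ex[of 0] by auto
      obtain y where y: "y \<in> S" "\<kappa> y = 1" using ex[of 1] by auto
      obtain z where z: "z \<in> S" "\<kappa> z = 2" using ex[of 2] by auto
      obtain w where w: "w \<in> S" "\<kappa> w = 3" using ex[of 3] by auto
      note xyzw = x(1) y(1) z(1) w(1) and k = x(2) y(2) z(2) w(2)
      have "x \<noteq> y" "x \<noteq> z" "x \<noteq> w" "y \<noteq> z" "y \<noteq> w" "z \<noteq> w" using k by auto
      then have "card {x, y, z, w} = 4" by simp
      then have "S = {x, y, z, w}"
        using xyzw S finS by (intro card_subset_eq[symmetric]) auto
      moreover have "x \<in> ?P 0" "y \<in> ?P 1" "z \<in> ?P 2" "w \<in> ?P 3"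
        using S xyzw k unfolding part_def by auto
      ultimately show "S \<in> {S \<in> F. \<exists>x\<in>?P 0. \<exists>y\<in>?P 1. \<exists>z\<in>?P 2. \<exists>w\<in>?P 3. S = {x, y, z, w}}"
        using SF by blast
    qed
  qed (use finF in auto)
  also have "\<dots> \<le> (\<Sum>x\<in>?P 0. \<Sum>y\<in>?P 1. \<Sum>z\<in>?P 2. \<Sum>w\<in>?P 3. of_bool ({x, y, z, w} \<in> F))"
    by (rule card_quadruples_le) (rule finP)+
  finally show ?thesis .
qed

lemma sum_of_bool_le:
  "(\<Sum>u\<in>A. \<Sum>v\<in>B. of_bool (P u v)) \<le> (card A * card B :: nat)"
proof -
  have "(\<Sum>u\<in>A. \<Sum>v\<in>B. of_bool (P u v)) \<le> (\<Sum>u\<in>A. \<Sum>v\<in>B. 1 :: nat)"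
    by (intro sum_mono) simp
  then show ?thesis by simp
qed

text \<open>Every transversal of the four parts contains exactly one pair for each of the six pairs of parts, and
a pair between parts \<open>i\<close> and \<open>j\<close> lies in \<open>Q / (p\<^sub>i * p\<^sub>j)\<close> of the \<open>Q\<close> transversals, where the \<open>p\<^sub>i\<close> are the
part sizes. Distribute the weight of each pair of the family evenly over the transversals
containing it. By the antichain property, a transversal either belongs to the family and receives
only its own weight 37, or receives at most \<open>36 * E / Q\<close>, where \<open>E\<close> is the number of pairs between
different parts. As \<open>E \<le> 37\<close> and \<open>Q \<le> 36\<close>, both amounts are at most \<open>36 * 37 / Q\<close>. The proof
multiplies by \<open>Q\<close> to stay in the natural numbers.\<close>

lemma multipartite_wt_le:
  assumes fin: "finite V" and V: "card V = 10" and F: "mixed V F"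
    and \<kappa>: "\<kappa> ` V \<subseteq> {..<4::nat}"
    and inj: "\<And>S. S \<in> F \<Longrightarrow> inj_on \<kappa> S"
  shows "wt F \<le> 36 * 37"
proof -
  define P where "P = part V \<kappa>"
  have finP: "finite (P i)" for i unfolding P_def part_def using fin by simp
  define a b c d where "a = card (P 0)" and "b = card (P 1)" and "c = card (P 2)" and "d = card (P 3)"
  have sum10: "a + b + c + d = 10"
    using card_parts[OF fin \<kappa>] V unfolding a_def b_def c_def d_def P_def by simp
  define E where "E = a*b + a*c + a*d + b*c + b*d + c*d"
  define Q where "Q = a*b*c*d"
  have E: "E \<le> 37" and Q: "Q \<le> 36"
    using pair_sum_le[OF sum10] prod_le[OF sum10] unfolding E_def Q_def .
  have finF: "finite F" using finite_mixed[OF F fin] .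
  define e where "e i j = (\<Sum>u\<in>P i. \<Sum>v\<in>P j. of_bool ({u, v} \<in> F) :: nat)" for i j
  define q where "q = (\<Sum>x\<in>P 0. \<Sum>y\<in>P 1. \<Sum>z\<in>P 2. \<Sum>w\<in>P 3. of_bool ({x, y, z, w} \<in> F) :: nat)"
  have e_le: "e i j \<le> card (P i) * card (P j)" for i j
    unfolding e_def by (rule sum_of_bool_le)

  let ?F2 = "{S \<in> F. card S = 2}" and ?F4 = "{S \<in> F. card S \<noteq> 2}"
  define e2 where "e2 i j = (\<Sum>u\<in>P i. \<Sum>v\<in>P j. of_bool ({u, v} \<in> ?F2) :: nat)" for i j
  have e2: "e2 i j \<le> e i j" for i j unfolding e_def e2_def by (intro sum_mono) simp
  have "card ?F2 \<le> e2 0 1 + e2 0 2 + e2 0 3 + e2 1 2 + e2 1 3 + e2 2 3"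
    by (rule card_bichromatic_pairs_le[OF fin \<kappa>]) (use mixedD(1)[OF F] inj in \<open>auto simp: e2_def P_def\<close>)
  also have "\<dots> \<le> e 0 1 + e 0 2 + e 0 3 + e 1 2 + e 1 3 + e 2 3" by (intro add_mono e2)
  finally have F2: "card ?F2 \<le> e 0 1 + e 0 2 + e 0 3 + e 1 2 + e 1 3 + e 2 3" .
  have "card ?F4 \<le> (\<Sum>x\<in>P 0. \<Sum>y\<in>P 1. \<Sum>z\<in>P 2. \<Sum>w\<in>P 3. of_bool ({x, y, z, w} \<in> ?F4))"
    unfolding P_def by (rule card_transversals_le[OF fin \<kappa>]) (use mixedD(1,2)[OF F] inj in auto)
  also have "\<dots> \<le> q" unfolding q_def by (intro sum_mono) simp
  finally have F4: "card ?F4 \<le> q" .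

  show ?thesis
  proof (cases "Q = 0")
    \<comment> \<open>With an empty part there are no transversals to average over, but also no 4-sets in the family.\<close>
    case True
    then have "P 0 = {} \<or> P 1 = {} \<or> P 2 = {} \<or> P 3 = {}"
      using finP unfolding Q_def a_def b_def c_def d_def by simp
    then have "q = 0" unfolding q_def by auto
    moreover have "e 0 1 + e 0 2 + e 0 3 + e 1 2 + e 1 3 + e 2 3 \<le> E"
      unfolding E_def a_def b_def c_def d_def by (intro add_mono e_le)
    ultimately show ?thesis using wt_eq[OF finF] F2 F4 E by linarith
  next
    case False
    have pt: "36 * (a*b * of_bool ({x, y} \<in> F) + a*c * of_bool ({x, z} \<in> F) + a*d * of_bool ({x, w} \<in> F)
        + b*c * of_bool ({y, z} \<in> F) + b*d * of_bool ({y, w} \<in> F) + c*d * of_bool ({z, w} \<in> F))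
        + 37 * Q * of_bool ({x, y, z, w} \<in> F) \<le> 36 * 37"
      if xyzw: "x \<in> P 0" "y \<in> P 1" "z \<in> P 2" "w \<in> P 3" for x y z w
    proof (cases "{x, y, z, w} \<in> F")
      case True
      have dist: "x \<noteq> y" "x \<noteq> z" "x \<noteq> w" "y \<noteq> z" "y \<noteq> w" "z \<noteq> w"
        using xyzw unfolding P_def part_def by auto
      have sub: "T \<notin> F" if "T \<subseteq> {x, y, z, w}" "T \<noteq> {x, y, z, w}" for T
        using mixedD(3)[OF F _ True] that by blast
      have "{x, y} \<notin> F" "{x, z} \<notin> F" "{x, w} \<notin> F" "{y, z} \<notin> F" "{y, w} \<notin> F" "{z, w} \<notin> F"
        by (rule sub; use dist in auto)+
      then show ?thesis using Q by simp
    next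
      case False
      have "a*b * of_bool ({x, y} \<in> F) + a*c * of_bool ({x, z} \<in> F) + a*d * of_bool ({x, w} \<in> F)
        + b*c * of_bool ({y, z} \<in> F) + b*d * of_bool ({y, w} \<in> F) + c*d * of_bool ({z, w} \<in> F) \<le> E"
        unfolding E_def by (intro add_mono) auto
      then show ?thesis using E False by simp
    qed
    have "(\<Sum>x\<in>P 0. \<Sum>y\<in>P 1. \<Sum>z\<in>P 2. \<Sum>w\<in>P 3.
        36 * (a*b * of_bool ({x, y} \<in> F) + a*c * of_bool ({x, z} \<in> F) + a*d * of_bool ({x, w} \<in> F)
        + b*c * of_bool ({y, z} \<in> F) + b*d * of_bool ({y, w} \<in> F) + c*d * of_bool ({z, w} \<in> F))
        + 37 * Q * of_bool ({x, y, z, w} \<in> F))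
      \<le> (\<Sum>x\<in>P 0. \<Sum>y\<in>P 1. \<Sum>z\<in>P 2. \<Sum>w\<in>P 3. 36 * 37)" (is "?L \<le> _")
      by (intro sum_mono pt)
    also have "\<dots> = Q * (36 * 37)" unfolding Q_def a_def b_def c_def d_def by simp
    also have "?L = Q * (36 * (e 0 1 + e 0 2 + e 0 3 + e 1 2 + e 1 3 + e 2 3) + 37 * q)"
      unfolding e_def q_def Q_def
      by (simp add: sum.distrib sum_distrib_left[symmetric] distrib_left distrib_right
          flip: a_def b_def[unfolded One_nat_def] c_def d_def)
    finally have "36 * (e 0 1 + e 0 2 + e 0 3 + e 1 2 + e 1 3 + e 2 3) + 37 * q \<le> 36 * 37"
      using False by simp
    moreover have "wt F \<le> 36 * (e 0 1 + e 0 2 + e 0 3 + e 1 2 + e 1 3 + e 2 3) + 37 * q"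
      unfolding wt_eq[OF finF] by (intro add_mono mult_le_mono2 F2 F4)
    ultimately show ?thesis by (rule order_trans[rotated])
  qed
qed

lemma exists_optimal:
  assumes "finite V"
  obtains F where "mixed V F" "\<And>G. mixed V G \<Longrightarrow> wt G \<le> wt F"
proof -
  have fin: "finite {F. mixed V F}"
  proof (rule finite_subset)
    show "{F. mixed V F} \<subseteq> Pow (Pow V)"
    proof (intro subsetI PowI)
      fix F S v assume "F \<in> {F. mixed V F}" "S \<in> F" "v \<in> S"
      then show "v \<in> V" using mixedD(1)[of V F S] by blast
    qed
  qed (use assms in simp)
  have "mixed V {}"
  proof -
    have False if X: "card X = 5" "\<And>u v. u \<in> X \<Longrightarrow> v \<in> X \<Longrightarrow> u = v" for X :: "'a set"
    proof -
      obtain u where "u \<in> X" using X(1) by fastforce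
      then have "X \<subseteq> {u}" using X(2) by blast
      then have "card X \<le> 1" using card_mono[of "{u}" X] by simp
      then show False using X(1) by simp
    qed
    then show ?thesis unfolding mixed_def covers_def by (simp, blast)
  qed
  then have "Max (wt ` {F. mixed V F}) \<in> wt ` {F. mixed V F}" using fin by (intro Max_in) auto
  then obtain F where F: "mixed V F" "Max (wt ` {F. mixed V F}) = wt F" by blast
  have "wt G \<le> wt F" if "mixed V G" for G
    unfolding F(2)[symmetric] using fin that by (intro Max_ge) auto
  then show ?thesis using that F(1) by blast
qed

lemma mixed_wt_le:
  assumes fin: "finite V" and V: "card V = 10" and G: "mixed V G"
  shows "wt G \<le> 36 * 37"
proof -
  obtain F where F: "mixed V F" and max: "\<And>G. mixed V G \<Longrightarrow> wt G \<le> wt F"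
    using exists_optimal[OF fin] by blast
  obtain \<kappa> where "\<kappa> ` V \<subseteq> {..<4::nat}"
    "\<And>u v. u \<in> V \<Longrightarrow> v \<in> V \<Longrightarrow> u \<noteq> v \<Longrightarrow> covers F u v \<longleftrightarrow> \<kappa> u \<noteq> \<kappa> v"
    using optimal_four_colouring[OF fin F max] by blast
  moreover have "inj_on \<kappa> S" if "S \<in> F" for S
    using calculation(2) mixedD(1)[OF F that] that unfolding covers_def inj_on_def by blast
  ultimately have "wt F \<le> 36 * 37" by (intro multipartite_wt_le[OF fin V F])
  then show ?thesis using max[OF G] by linarith
qed

section \<open>From hypergraphs to mixed families\<close>

abbreviation pairs :: "'a set \<Rightarrow> 'a set set" where
  "pairs X \<equiv> {p. p \<subseteq> X \<and> card p = 2}"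

lemma pairs_image:
  assumes "bij_betw g A B"
  shows "(\<lambda>e. g ` e) ` pairs A = pairs B"
proof
  have inj: "inj_on g A" and B: "B = g ` A" using assms by (auto simp: bij_betw_def)
  show "(\<lambda>e. g ` e) ` pairs A \<subseteq> pairs B"
    using inj by (auto simp: B card_image inj_on_subset)
  show "pairs B \<subseteq> (\<lambda>e. g ` e) ` pairs A"
  proof
    fix p assume p: "p \<in> pairs B"
    then obtain e where e: "e \<subseteq> A" "p = g ` e" unfolding B by (auto simp: subset_image_iff)
    then have "card e = 2" using p card_image[OF inj_on_subset[OF inj e(1)]] by simp
    then show "p \<in> (\<lambda>e. g ` e) ` pairs A" using e by blast
  qed
qed

lemma berge_free_K5D:
  assumes H: "is_hypergraph H" "berge_free (complete_graph 5) H"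
    and X: "X \<subseteq> verts H" "card X = 5"
    and \<phi>: "inj_on \<phi> (pairs X)" "\<And>p. p \<in> pairs X \<Longrightarrow> \<phi> p \<in> hyperedges H \<and> p \<subseteq> \<phi> p"
  shows False
proof -
  have "finite X" using X(2) by (intro card_ge_0_finite) simp
  then obtain g where g: "bij_betw g {..<5::nat} X"
    using finite_same_card_bij[of "{..<5::nat}" X] X(2) by auto
  have "isomorphic (complete_graph 5) (X, pairs X)"
    unfolding isomorphic_def complete_graph_def using g pairs_image[OF g] by (intro exI[of _ g]) simp
  moreover have "subhypergraph (verts H, \<phi> ` pairs X) H"
    using H(1) \<phi>(2) unfolding subhypergraph_def is_hypergraph_def by auto
  moreover have "berge_copy (X, pairs X) (verts H, \<phi> ` pairs X)"
    unfolding berge_copy_def using X(1) \<phi> by (auto simp: bij_betw_def intro!: exI[of _ \<phi>])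
  ultimately show False using H(2) unfolding berge_free_def by blast
qed

text \<open>In the covered graph every pair of vertices either is the partner of a hyperedge outside \<open>U\<close>, or
lies in a member of \<open>U\<close> and then has a partner in \<open>U\<close>. Hence a \<open>K\<^sub>5\<close> in this graph would be the core
of a Berge-\<open>K\<^sub>5\<close>. The family is an antichain because the partners of hyperedges outside \<open>U\<close> lie in
no member of \<open>U\<close>.\<close>

lemma reduce_to_mixed:
  assumes H: "is_hypergraph H" "uniform 4 H" "berge_free (complete_graph 5) H"
  obtains U f where "U \<subseteq> hyperedges H" "inj_on f (hyperedges H - U)"
    "\<And>h. h \<in> hyperedges H - U \<Longrightarrow> f h \<in> pairs h"
    "mixed (verts H) (U \<union> f ` (hyperedges H - U))"
proof -
  let ?I = "hyperedges H"
  have finV: "finite (verts H)" and sub: "\<And>h. h \<in> ?I \<Longrightarrow> h \<subseteq> verts H"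
    using H(1) unfolding is_hypergraph_def by auto
  have c4: "card h = 4" if "h \<in> ?I" for h using H(2) that unfolding uniform_def by blast
  have finI: "finite ?I" using finV sub by (intro finite_subset[of ?I "Pow (verts H)"]) auto
  have fin: "finite h" if "h \<in> ?I" for h using sub[OF that] finV finite_subset by blast
  obtain U f g where U: "U \<subseteq> ?I"
    and f: "inj_on f (?I - U)" "\<And>h. h \<in> ?I - U \<Longrightarrow> f h \<in> pairs h - \<Union> (pairs ` U)"
    and g: "inj_on g (\<Union> (pairs ` U))" "\<And>p. p \<in> \<Union> (pairs ` U) \<Longrightarrow> g p \<in> U \<and> p \<in> pairs (g p)"
    using deficiency_split[of ?I pairs] finI fin by auto
  define F where "F = U \<union> f ` (?I - U)"
  have cases: "S \<in> U \<and> S \<in> ?I \<and> card S = 4 \<or> S \<notin> U \<and> (\<exists>h \<in> ?I - U. S = f h \<and> S \<subseteq> h \<and> card S = 2)"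
    if "S \<in> F" for S
  proof (cases "S \<in> U")
    case True then show ?thesis using U c4 by blast
  next
    case False
    then obtain h where "h \<in> ?I - U" "S = f h" using \<open>S \<in> F\<close> unfolding F_def by blast
    then show ?thesis using f(2)[of h] False by auto
  qed
  have "mixed (verts H) F"
  proof -
    have edge: "S \<subseteq> verts H \<and> (card S = 2 \<or> card S = 4)" if "S \<in> F" for S
      using cases[OF that] sub by blast
    have finF: "finite S" if "S \<in> F" for S using edge[OF that] finV finite_subset by blast
    have antichain: "S = T" if ST: "S \<in> F" "T \<in> F" "S \<subseteq> T" for S T
    proof (cases "card S = card T")
      case True
      then show ?thesis using card_subset_eq[OF finF[OF ST(2)] ST(3)] by simp
    next
      case False
      have "card S \<le> card T" using card_mono[OF finF[OF ST(2)] ST(3)] .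
      then have c: "card S = 2" "card T = 4" using False edge[OF ST(1)] edge[OF ST(2)] by auto
      have T: "T \<in> U" using cases[OF ST(2)] c by auto
      obtain h where "h \<in> ?I - U" "S = f h" using cases[OF ST(1)] c by auto
      then have "S \<notin> pairs T" using f(2)[of h] T by blast
      then show ?thesis using c ST(3) by simp
    qed
    have no_K5: False
      if X: "X \<subseteq> verts H" "card X = 5" "\<And>u v. u \<in> X \<Longrightarrow> v \<in> X \<Longrightarrow> u \<noteq> v \<Longrightarrow> covers F u v" for X
    proof -
      let ?N = "\<Union> (pairs ` U)"
      have pair: "p \<in> ?N \<or> p \<in> f ` (?I - U)" if p: "p \<in> pairs X" for p
      proof -
        obtain u v where uv: "p = {u, v}" "u \<noteq> v" using p card_2_iff[of p] by blast
        then have "covers F u v" using X(3) p by blast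
        then obtain S where S: "S \<in> F" "p \<subseteq> S" unfolding covers_def uv(1) by blast
        show ?thesis
        proof (cases "S \<in> U")
          case True then show ?thesis using S p by blast
        next
          case False
          then have "card S = 2" "S \<in> f ` (?I - U)" using cases[OF S(1)] by auto
          moreover have "p = S"
            using card_subset_eq[OF finF[OF S(1)] S(2)] p \<open>card S = 2\<close> by simp
          ultimately show ?thesis by simp
        qed
      qed
      define \<phi> where "\<phi> p = (if p \<in> ?N then g p else inv_into (?I - U) f p)" for p
      have in1: "\<phi> p \<in> U \<and> p \<subseteq> \<phi> p" if "p \<in> ?N" for p
        using g(2)[OF that] that unfolding \<phi>_def by auto
      have in2: "\<phi> p \<in> ?I - U \<and> f (\<phi> p) = p" if "p \<in> pairs X" "p \<notin> ?N" for p
      proof -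
        have "p \<in> f ` (?I - U)" using pair[OF that(1)] that(2) by blast
        moreover have "\<phi> p = inv_into (?I - U) f p" using that(2) unfolding \<phi>_def by (rule if_not_P)
        ultimately show ?thesis
          using inv_into_into[of p f "?I - U"] f_inv_into_f[of p f "?I - U"] by metis
      qed
      have "inj_on \<phi> (pairs X)"
      proof (rule inj_onI)
        fix p p' assume p: "p \<in> pairs X" "p' \<in> pairs X" "\<phi> p = \<phi> p'"
        show "p = p'"
        proof (cases "p \<in> ?N")
          case True
          then have "p' \<in> ?N" using in1[OF True] in2[OF p(2)] p(3) by auto
          then have "g p = g p'" using p(3) True unfolding \<phi>_def by simp
          then show ?thesis using inj_onD[OF g(1)] True \<open>p' \<in> ?N\<close> by blast
        next
          case False
          then have "p' \<notin> ?N" using in2[OF p(1)] in1[of p'] p(3) by auto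
          then show ?thesis using in2[OF p(1) False] in2[OF p(2)] p(3) by metis
        qed
      qed
      moreover have "\<phi> p \<in> ?I \<and> p \<subseteq> \<phi> p" if "p \<in> pairs X" for p
      proof (cases "p \<in> ?N")
        case True then show ?thesis using in1 U by blast
      next
        case False
        have "f (\<phi> p) \<subseteq> \<phi> p" using f(2)[of "\<phi> p"] in2[OF that False] by blast
        then show ?thesis using in2[OF that False] by auto
      qed
      ultimately show False by (rule berge_free_K5D[OF H(1,3) X(1,2)])
    qed
    show ?thesis unfolding mixed_def
      using edge antichain no_K5 by (intro conjI ballI impI notI; (elim exE conjE)?) meson+
  qed
  then show ?thesis using that[of U f] U f unfolding F_def by blast
qed

text \<open>Here each hyperedge has its own pair, and the pairs form a complete 4-partite graph. As this graph has
at least 37 edges, all parts have at least two vertices. If \<open>h\<close> contains two vertices \<open>u\<close>, \<open>v\<close> of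
one part, then \<open>h\<close> is released from its pair \<open>f h\<close> and used for \<open>{u, v}\<close> instead. A \<open>K\<^sub>5\<close> on \<open>u\<close>, \<open>v\<close>
and one vertex from each other part that avoids the released edge exists: it suffices to avoid one end \<open>w\<close>
of that edge outside \<open>{u, v}\<close>, and the parts are large enough for that.\<close>

lemma saturated_edges_transversal:
  assumes H: "is_hypergraph H" "berge_free (complete_graph 5) H" and V: "card (verts H) = 10"
    and f: "inj_on f (hyperedges H)" "\<And>k. k \<in> hyperedges H \<Longrightarrow> f k \<in> pairs k"
    and \<kappa>: "\<kappa> ` verts H \<subseteq> {..<4::nat}"
    and col: "\<And>u v. u \<in> verts H \<Longrightarrow> v \<in> verts H \<Longrightarrow> u \<noteq> v \<Longrightarrow>
      {u, v} \<in> f ` hyperedges H \<longleftrightarrow> \<kappa> u \<noteq> \<kappa> v"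
    and big: "37 \<le> card (hyperedges H)"
    and h: "h \<in> hyperedges H"
  shows "inj_on \<kappa> h"
proof (rule inj_onI, rule ccontr)
  let ?V = "verts H" and ?F = "f ` hyperedges H"
  fix u v assume uv: "u \<in> h" "v \<in> h" "\<kappa> u = \<kappa> v" "u \<noteq> v"
  have fin: "finite ?V" and sub: "\<And>h. h \<in> hyperedges H \<Longrightarrow> h \<subseteq> ?V"
    using H(1) unfolding is_hypergraph_def by auto
  have uvV: "u \<in> ?V" "v \<in> ?V" using sub[OF h] uv(1,2) by auto
  have ku: "\<kappa> u < 4" using \<kappa> uvV(1) by auto
  have F: "S \<subseteq> ?V \<and> card S = 2" if "S \<in> ?F" for S using f(2) sub that by fastforce
  have injF: "inj_on \<kappa> S" if S: "S \<in> ?F" for S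
  proof (rule inj_onI, rule ccontr)
    fix s t assume st: "s \<in> S" "t \<in> S" "\<kappa> s = \<kappa> t" "s \<noteq> t"
    have "finite S" using F[OF S] card_ge_0_finite[of S] by simp
    then have "S = {s, t}" using F[OF S] st card_subset_eq[of S "{s, t}"] by simp
    then show False using col[of s t] F[OF S] S st by auto
  qed
  define P where "P = part ?V \<kappa>"
  have parts: "2 \<le> card (P i)" if "i < 4" for i
  proof -
    define e where "e i j = (\<Sum>u\<in>P i. \<Sum>v\<in>P j. of_bool ({u, v} \<in> ?F) :: nat)" for i j
    have e_le: "e i j \<le> card (P i) * card (P j)" for i j
      unfolding e_def by (rule sum_of_bool_le)
    have "37 \<le> card ?F" using big card_image[OF f(1)] by simp
    also have "\<dots> \<le> e 0 1 + e 0 2 + e 0 3 + e 1 2 + e 1 3 + e 2 3"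
      by (rule card_bichromatic_pairs_le[OF fin \<kappa>]) (use F injF in \<open>auto simp: e_def P_def\<close>)
    also have "\<dots> \<le> card (P 0) * card (P 1) + card (P 0) * card (P 2) + card (P 0) * card (P 3)
      + card (P 1) * card (P 2) + card (P 1) * card (P 3) + card (P 2) * card (P 3)"
      by (intro add_mono e_le)
    finally have E: "37 \<le> card (P 0) * card (P 1) + card (P 0) * card (P 2) + card (P 0) * card (P 3)
      + card (P 1) * card (P 2) + card (P 1) * card (P 3) + card (P 2) * card (P 3)" .
    have sum: "card (P 0) + card (P 1) + card (P 2) + card (P 3) = 10"
      using card_parts[OF fin \<kappa>] V unfolding P_def by simp
    \<comment> \<open>The bound is symmetric in the parts, so each part in turn can take the first place.\<close>
    have "2 \<le> card (P 0)" "2 \<le> card (P 1)" "2 \<le> card (P 2)" "2 \<le> card (P 3)"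
      using two_le_part_if_pair_sum[of "card (P 0)" "card (P 1)" "card (P 2)" "card (P 3)"]
        two_le_part_if_pair_sum[of "card (P 1)" "card (P 0)" "card (P 2)" "card (P 3)"]
        two_le_part_if_pair_sum[of "card (P 2)" "card (P 1)" "card (P 0)" "card (P 3)"]
        two_le_part_if_pair_sum[of "card (P 3)" "card (P 1)" "card (P 2)" "card (P 0)"] sum E
      by (simp_all add: algebra_simps)
    moreover have "i = 0 \<or> i = 1 \<or> i = 2 \<or> i = 3" using that by arith
    ultimately show ?thesis by blast
  qed
  have fh: "f h \<in> ?F" using h by blast
  obtain w where w: "w \<in> f h" "w \<noteq> u" "w \<noteq> v"
  proof -
    have "\<not> f h \<subseteq> {u, v}"
    proof
      assume "f h \<subseteq> {u, v}"
      then have "f h = {u, v}" using F[OF fh] uv(4) by (intro card_subset_eq) auto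
      then show False using injF[OF fh] uv(3,4) by (auto simp: inj_on_def)
    qed
    then show ?thesis using that by blast
  qed
  have "\<exists>y. y \<in> P i \<and> y \<noteq> w" if "i < 4" for i
  proof (rule ccontr)
    assume "\<not> ?thesis"
    then have "P i \<subseteq> {w}" by blast
    then have "card (P i) \<le> 1" using card_mono[of "{w}" "P i"] by simp
    then show False using parts[OF that] by simp
  qed
  then obtain x where x: "\<And>i. i < 4 \<Longrightarrow> x i \<in> P i \<and> x i \<noteq> w" by metis
  have kx: "\<kappa> (x i) = i" "x i \<in> ?V" if "i < 4" for i
    using x[OF that] unfolding P_def part_def by auto
  define I where "I = {..<4} - {\<kappa> u}"
  have I: "i < 4 \<and> i \<noteq> \<kappa> u" if "i \<in> I" for i using that unfolding I_def by auto
  define X where "X = {u, v} \<union> x ` I"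
  have XV: "X \<subseteq> ?V" using uvV kx I unfolding X_def by blast
  have cardX: "card X = 5"
  proof -
    have "inj_on x I" using kx(1) I by (metis inj_onI)
    then have "card (x ` I) = 3" using ku unfolding I_def by (simp add: card_image)
    moreover have "{u, v} \<inter> x ` I = {}" using kx(1) I uv(3) by fastforce
    moreover have "finite (x ` I)" unfolding I_def by simp
    ultimately show ?thesis unfolding X_def using uv(4) by (subst card_Un_disjoint) auto
  qed
  have wX: "w \<notin> X" using w x I unfolding X_def by blast
  have ne: "\<kappa> s \<noteq> \<kappa> t" if st: "s \<in> X" "t \<in> X" "s \<noteq> t" "{s, t} \<noteq> {u, v}" for s t
  proof -
    have "\<kappa> s \<noteq> \<kappa> u \<or> \<kappa> t \<noteq> \<kappa> u"
    proof (rule ccontr)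
      assume "\<not> ?thesis"
      then have "s \<in> {u, v}" "t \<in> {u, v}" using st(1,2) kx(1) I unfolding X_def by fastforce+
      then show False using st(3,4) by blast
    qed
    moreover have "y = x (\<kappa> y)" if "y \<in> X" "\<kappa> y \<noteq> \<kappa> u" for y
      using that kx(1) I uv(3) unfolding X_def by auto
    ultimately show ?thesis using st by metis
  qed
  have inF: "p \<in> ?F" "p \<noteq> f h" if p: "p \<in> pairs X" "p \<noteq> {u, v}" for p
  proof -
    obtain s t where st: "p = {s, t}" "s \<noteq> t" using p card_2_iff[of p] by blast
    then have "s \<in> X" "t \<in> X" using p(1) by auto
    then show "p \<in> ?F" using col[of s t] ne[of s t] st p(2) XV by auto
    show "p \<noteq> f h" using w(1) wX p(1) by blast
  qed
  let ?g = "inv_into (hyperedges H) f"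
  define \<phi> where "\<phi> p = (if p = {u, v} then h else ?g p)" for p
  have "\<phi> p \<in> hyperedges H \<and> p \<subseteq> \<phi> p" if p: "p \<in> pairs X" for p
  proof (cases "p = {u, v}")
    case True then show ?thesis unfolding \<phi>_def using h uv by auto
  next
    case False
    have "?g p \<in> hyperedges H" "f (?g p) = p"
      using inF(1)[OF p False] inv_into_into f_inv_into_f by metis+
    then show ?thesis using f(2)[of "?g p"] False unfolding \<phi>_def by auto
  qed
  moreover have "inj_on \<phi> (pairs X)"
  proof (rule inj_onI)
    fix p q assume pq: "p \<in> pairs X" "q \<in> pairs X" "\<phi> p = \<phi> q"
    have *: "\<phi> r \<noteq> h \<and> f (\<phi> r) = r" if "r \<in> pairs X" "r \<noteq> {u, v}" for r
      using inF[OF that] f_inv_into_f[of r f "hyperedges H"] that(2) unfolding \<phi>_def by auto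
    have **: "\<phi> {u, v} = h" unfolding \<phi>_def by simp
    show "p = q" using *[OF pq(1)] *[OF pq(2)] ** pq(3) by metis
  qed
  ultimately show False using berge_free_K5D[OF H XV cardX] by blast
qed

section \<open>Upper and lower bound on ten vertices\<close>

lemma berge_K5_upper:
  assumes H: "is_hypergraph H" "uniform 4 H" "berge_free (complete_graph 5) H"
    and V: "card (verts H) = 10"
  shows "card (hyperedges H) \<le> 36"
proof (rule ccontr)
  assume "\<not> ?thesis"
  then have big: "37 \<le> card (hyperedges H)" by simp
  let ?V = "verts H" and ?I = "hyperedges H"
  have fin: "finite ?V" and sub: "\<And>h. h \<in> ?I \<Longrightarrow> h \<subseteq> ?V"
    using H(1) unfolding is_hypergraph_def by auto
  have c4: "card h = 4" if "h \<in> ?I" for h using H(2) that unfolding uniform_def by blast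
  have finI: "finite ?I" using fin sub by (intro finite_subset[of ?I "Pow ?V"]) auto
  obtain U f where U: "U \<subseteq> ?I" and f: "inj_on f (?I - U)" "\<And>h. h \<in> ?I - U \<Longrightarrow> f h \<in> pairs h"
    and mixed: "mixed ?V (U \<union> f ` (?I - U))"
    using reduce_to_mixed[OF H] by blast
  let ?F = "U \<union> f ` (?I - U)"
  have finU: "finite U" using U finI finite_subset by blast
  have finF: "finite ?F" using finU finI by simp
  have c2: "card S = 2" if "S \<in> f ` (?I - U)" for S using f(2) that by blast
  have "{S \<in> ?F. card S = 2} = f ` (?I - U)" using c2 c4 U by fastforce
  moreover have "{S \<in> ?F. card S \<noteq> 2} = U" using c2 c4 U by fastforce
  ultimately have wt: "wt ?F = 36 * card (?I - U) + 37 * card U"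
    using wt_eq[OF finF] card_image[OF f(1)] by simp
  have "card ?I = card (?I - U) + card U"
    using card_Diff_subset[OF finU U] card_mono[OF finI U] by simp
  then have "wt ?F = 36 * card ?I + card U" using wt by simp
  moreover have "wt ?F \<le> 36 * 37" by (rule mixed_wt_le[OF fin V mixed])
  ultimately have "card U = 0" and wt37: "36 * 37 \<le> wt ?F" using big by linarith+
  then have "U = {}" using finU by simp
  then have f': "inj_on f ?I" "\<And>h. h \<in> ?I \<Longrightarrow> f h \<in> pairs h" and mixed': "mixed ?V (f ` ?I)"
    and wt': "36 * 37 \<le> wt (f ` ?I)"
    using f mixed wt37 by simp_all
  have max: "wt G \<le> wt (f ` ?I)" if "mixed ?V G" for G
    using mixed_wt_le[OF fin V that] wt' by linarith
  obtain \<kappa> where \<kappa>: "\<kappa> ` ?V \<subseteq> {..<4::nat}"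
    and cov: "\<And>u v. u \<in> ?V \<Longrightarrow> v \<in> ?V \<Longrightarrow> u \<noteq> v \<Longrightarrow> covers (f ` ?I) u v \<longleftrightarrow> \<kappa> u \<noteq> \<kappa> v"
    using optimal_four_colouring[OF fin mixed' max] by blast
  have covers: "covers (f ` ?I) u v \<longleftrightarrow> {u, v} \<in> f ` ?I" if "u \<noteq> v" for u v
  proof
    assume "covers (f ` ?I) u v"
    then obtain S where S: "S \<in> f ` ?I" "u \<in> S" "v \<in> S" unfolding covers_def by blast
    then have "card S = 2" using f'(2) by blast
    then have "S = {u, v}" using S(2,3) that by (auto simp: card_2_iff)
    then show "{u, v} \<in> f ` ?I" using S(1) by simp
  qed (auto simp: covers_def)
  have "inj_on \<kappa> h" if "h \<in> ?I" for h
    using saturated_edges_transversal[OF H(1,3) V f' \<kappa> _ big that] cov covers by blast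
  then have "card ?I \<le> (\<Sum>x\<in>part ?V \<kappa> 0. \<Sum>y\<in>part ?V \<kappa> 1. \<Sum>z\<in>part ?V \<kappa> 2. \<Sum>w\<in>part ?V \<kappa> 3.
      of_bool ({x, y, z, w} \<in> ?I))"
    using sub c4 by (intro card_transversals_le[OF fin \<kappa>]) auto
  also have "\<dots> \<le> (\<Sum>x\<in>part ?V \<kappa> 0. \<Sum>y\<in>part ?V \<kappa> 1. \<Sum>z\<in>part ?V \<kappa> 2. \<Sum>w\<in>part ?V \<kappa> 3. 1)"
    by (intro sum_mono) simp
  also have "\<dots> \<le> 36"
    using prod_le[of "card (part ?V \<kappa> 0)" "card (part ?V \<kappa> 1)" "card (part ?V \<kappa> 2)" "card (part ?V \<kappa> 3)"]
      card_parts[OF fin \<kappa>] V by simp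
  finally show False using big by simp
qed

text \<open>By the pigeonhole principle two of the five core vertices have the same colour, and a hyperedge
coloured injectively cannot contain both.\<close>

lemma four_partite_berge_free:
  fixes H :: "'a hypergraph"
  assumes "\<And>v. v \<in> verts H \<Longrightarrow> \<kappa> v < (4::nat)"
    and "\<And>h. h \<in> hyperedges H \<Longrightarrow> inj_on \<kappa> h"
  shows "berge_free (complete_graph 5) H"
  unfolding berge_free_def
proof
  assume "\<exists>F' H'. isomorphic (complete_graph 5) F' \<and> subhypergraph H' H \<and> berge_copy F' H'"
  then obtain F' H' :: "'a hypergraph" where iso: "isomorphic (complete_graph 5) F'"
    and sub: "subhypergraph H' H" and copy: "berge_copy F' H'" by blast
  obtain g where g: "bij_betw g {..<5::nat} (verts F')"
    and E: "hyperedges F' = (\<lambda>e. g ` e) ` pairs {..<5}"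
    using iso unfolding isomorphic_def complete_graph_def by auto
  have E': "hyperedges F' = pairs (verts F')" unfolding E using pairs_image[OF g] .
  have card: "card (verts F') = 5" using bij_betw_same_card[OF g] by simp
  have V: "verts F' \<subseteq> verts H" using copy sub unfolding berge_copy_def subhypergraph_def by auto
  have "\<not> inj_on \<kappa> (verts F')"
  proof
    assume "inj_on \<kappa> (verts F')"
    then have "card (verts F') \<le> card {..<4::nat}"
      using V assms(1) by (intro card_inj_on_le[of \<kappa>]) auto
    then show False using card by simp
  qed
  then obtain u v where uv: "u \<in> verts F'" "v \<in> verts F'" "u \<noteq> v" "\<kappa> u = \<kappa> v"
    unfolding inj_on_def by blast
  have uvE: "{u, v} \<in> hyperedges F'" using uv unfolding E' by simp
  obtain f where f: "bij_betw f (hyperedges F') (hyperedges H')" "\<forall>e\<in>hyperedges F'. e \<subseteq> f e"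
    using copy unfolding berge_copy_def by blast
  have "f {u, v} \<in> hyperedges H" "{u, v} \<subseteq> f {u, v}"
    using f uvE sub bij_betwE[OF f(1)] unfolding subhypergraph_def by auto
  then show False using assms(2) uv(3,4) unfolding inj_on_def by blast
qed

lemma card_transversals:
  assumes "A \<inter> B = {}" "A \<inter> C = {}" "A \<inter> D = {}" "B \<inter> C = {}" "B \<inter> D = {}" "C \<inter> D = {}"
  shows "card ((\<lambda>(a, b, c, d). {a, b, c, d}) ` (A \<times> B \<times> C \<times> D)) = card A * card B * card C * card D"
proof -
  have "inj_on (\<lambda>(a, b, c, d). {a, b, c, d}) (A \<times> B \<times> C \<times> D)"
  proof (rule inj_onI)
    fix p q
    assume p: "p \<in> A \<times> B \<times> C \<times> D" and q: "q \<in> A \<times> B \<times> C \<times> D"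
      and pq: "(\<lambda>(a, b, c, d). {a, b, c, d}) p = (\<lambda>(a, b, c, d). {a, b, c, d}) q"
    obtain a b c d a' b' c' d' where "p = (a, b, c, d)" "q = (a', b', c', d')"
      using prod_cases4 by metis
    then have m: "a \<in> A" "b \<in> B" "c \<in> C" "d \<in> D" "a' \<in> A" "b' \<in> B" "c' \<in> C" "d' \<in> D"
      and eq: "{a, b, c, d} = {a', b', c', d'}"
      and pq_eq: "p = (a, b, c, d)" "q = (a', b', c', d')" using p q pq by auto
    have "{a, b, c, d} \<inter> A = {a}" "{a, b, c, d} \<inter> B = {b}" "{a, b, c, d} \<inter> C = {c}"
      "{a, b, c, d} \<inter> D = {d}" using m(1-4) assms by blast+
    moreover have "{a', b', c', d'} \<inter> A = {a'}" "{a', b', c', d'} \<inter> B = {b'}"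
      "{a', b', c', d'} \<inter> C = {c'}" "{a', b', c', d'} \<inter> D = {d'}" using m(5-8) assms by blast+
    ultimately show "p = q" unfolding eq pq_eq by simp
  qed
  then show ?thesis by (simp add: card_image card_cartesian_product mult.assoc)
qed

lemma berge_K5_lower: "36 \<in> berge_free_sizes 4 10 (complete_graph 5)"
proof -
  \<comment> \<open>The parts are the residue classes modulo 4, of sizes 3, 3, 2, 2.\<close>
  let ?\<kappa> = "\<lambda>v::nat. v mod 4"
  let ?A = "{0, 4, 8::nat}" and ?B = "{1, 5, 9::nat}" and ?C = "{2, 6::nat}" and ?D = "{3, 7::nat}"
  define E where "E = (\<lambda>(a, b, c, d). {a, b, c, d}) ` (?A \<times> ?B \<times> ?C \<times> ?D)"
  have "card E = card ?A * card ?B * card ?C * card ?D"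
    unfolding E_def by (rule card_transversals) auto
  then have cardE: "card E = 36" by simp
  have E: "h \<subseteq> {..<10} \<and> card h = 4 \<and> inj_on ?\<kappa> h" if hE: "h \<in> E" for h
  proof -
    obtain a b c d where h: "h = {a, b, c, d}" and m: "a \<in> ?A" "b \<in> ?B" "c \<in> ?C" "d \<in> ?D"
      using hE unfolding E_def by blast
    have k: "a mod 4 = 0" "b mod 4 = 1" "c mod 4 = 2" "d mod 4 = 3" using m by auto
    have "a \<noteq> b" "a \<noteq> c" "a \<noteq> d" "b \<noteq> c" "b \<noteq> d" "c \<noteq> d" using k by auto
    then have "card h = 4" unfolding h by simp
    moreover have "inj_on ?\<kappa> h" unfolding h inj_on_def using k by auto
    moreover have "h \<subseteq> {..<10}" unfolding h using m by auto
    ultimately show ?thesis by blast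
  qed
  have "berge_free (complete_graph 5) ({..<10}, E)"
    by (rule four_partite_berge_free[of _ ?\<kappa>]) (use E in auto)
  then show ?thesis
    unfolding berge_free_sizes_def is_hypergraph_def uniform_def using E cardE
    by (intro CollectI exI[of _ "({..<10}, E)"]) auto
qed

theorem mainTheorem3: "ex_berge 4 10 (complete_graph 5) = 36"
  unfolding ex_berge_def
proof (rule Max_eqI)
  show "finite (berge_free_sizes 4 10 (complete_graph 5))" by (rule finite_berge_free_sizes)
  show "m \<le> 36" if "m \<in> berge_free_sizes 4 10 (complete_graph 5)" for m
    using that berge_K5_upper unfolding berge_free_sizes_def by blast
  show "36 \<in> berge_free_sizes 4 10 (complete_graph 5)" by (rule berge_K5_lower)
qed

end
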